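(* Let $\mathsf{K}^c_n$ be a complete convex graph of order $n$, with edge adjacency defined by the edge-intersection criterion or by the edge-crossing criterion. In either case, the pseudo-Grundy index $\gamma'(\mathsf{K}^c_n)$ is at most $O\left(\frac{n^2}{\sqrt{24}}\right)$.
   Context: A geometric graph is a drawing of a graph in the plane in which the vertices are points in general position (no three collinear) and every edge is the straight-line segment joining its endpoints. A complete convex graph $\mathsf{K}^c_n$ of order $n$ is a geometric graph of the complete graph $K_n$ whose $n$ vertices are in convex position. Two distinct edges cross if they meet at a point interior to both segments; they intersect if they share an endpoint or cross. Edge-intersection criterion: two distinct edges are adjacent if and only if they intersect. Edge-crossing criterion: two distinct edges are adjacent if and only if they cross. A pseudo-Grundy $k$-coloring is an assignment of the colors $1,\dots,k$ to all the edges (not necessarily proper), with every color used, such that for every pair of colors $i<j$, every edge of color $j$ is adjacent to at least one edge of color $i$. The pseudo-Grundy index $\gamma'(\mathsf{G})$ of a geometric graph $\mathsf{G}$ is the largest $k$ for which $\mathsf{G}$ has a pseudo-Grundy $k$-coloring. The asymptotic notation is as $n\to\infty$. *)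

theory Defs
  imports "HOL-Analysis.Analysis" "HOL-Library.Landau_Symbols"
begin

type_synonym point = "real^2"

text \<open>An edge is the two-element set of its endpoints; its drawing is the segment between them.\<close>

type_synonym edge = "point set"

definition general_position :: "point set \<Rightarrow> bool" where
  "general_position V \<longleftrightarrow>
     (\<forall>a\<in>V. \<forall>b\<in>V. \<forall>c\<in>V. a \<noteq> b \<and> a \<noteq> c \<and> b \<noteq> c \<longrightarrow> \<not> collinear {a, b, c})"

definition convex_position :: "point set \<Rightarrow> bool" where
  "convex_position V \<longleftrightarrow> (\<forall>v\<in>V. v \<notin> convex hull (V - {v}))"

definition geometric_graph :: "point set \<Rightarrow> edge set \<Rightarrow> bool" where
  "geometric_graph V E \<longleftrightarrow>
     finite V \<and> general_position V \<and> (\<forall>e\<in>E. e \<subseteq> V \<and> card e = 2)"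

definition complete_convex_graph :: "nat \<Rightarrow> point set \<Rightarrow> edge set \<Rightarrow> bool" where
  "complete_convex_graph n V E \<longleftrightarrow>
     geometric_graph V E \<and> card V = n \<and> E = {e. e \<subseteq> V \<and> card e = 2} \<and> convex_position V"

definition edges_cross :: "edge \<Rightarrow> edge \<Rightarrow> bool" where
  "edges_cross e f \<longleftrightarrow>
     e \<noteq> f \<and>
     (\<exists>a b c d. e = {a, b} \<and> f = {c, d} \<and> open_segment a b \<inter> open_segment c d \<noteq> {})"

definition edges_intersect :: "edge \<Rightarrow> edge \<Rightarrow> bool" where
  "edges_intersect e f \<longleftrightarrow> e \<noteq> f \<and> (e \<inter> f \<noteq> {} \<or> edges_cross e f)"

text \<open>The relation \<open>adj\<close> is the adjacency criterion on edges. The equation \<open>c ` E = {1..k}\<close>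
  says that all edges get a color in \<open>{1..k}\<close> and that every color is used.\<close>

definition pseudo_grundy_coloring ::
  "(edge \<Rightarrow> edge \<Rightarrow> bool) \<Rightarrow> edge set \<Rightarrow> nat \<Rightarrow> (edge \<Rightarrow> nat) \<Rightarrow> bool" where
  "pseudo_grundy_coloring adj E k c \<longleftrightarrow>
     c ` E = {1..k} \<and>
     (\<forall>i\<in>{1..k}. \<forall>j\<in>{1..k}. i < j \<longrightarrow>
        (\<forall>e\<in>E. c e = j \<longrightarrow> (\<exists>f\<in>E. c f = i \<and> adj e f)))"

definition pseudo_grundy_index :: "(edge \<Rightarrow> edge \<Rightarrow> bool) \<Rightarrow> edge set \<Rightarrow> nat" where
  "pseudo_grundy_index adj E = Max {k. \<exists>c. pseudo_grundy_coloring adj E k c}"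

text \<open>For a finite graph the maximum is taken over a finite nonempty set.\<close>

lemma pseudo_grundy_coloring_le_card:
  assumes "finite E" "pseudo_grundy_coloring adj E k c"
  shows "k \<le> card E"
proof -
  have "c ` E = {1..k}"
    using assms(2) unfolding pseudo_grundy_coloring_def by (rule conjunct1)
  then show ?thesis
    using card_image_le[OF assms(1), of c] by simp
qed

lemma finite_pseudo_grundy_colorings:
  assumes "finite E"
  shows "finite {k. \<exists>c. pseudo_grundy_coloring adj E k c}"
proof (rule finite_subset)
  show "{k. \<exists>c. pseudo_grundy_coloring adj E k c} \<subseteq> {..card E}"
    by (blast intro: pseudo_grundy_coloring_le_card[OF assms])
qed simp

lemma ex_pseudo_grundy_coloring: "\<exists>k c. pseudo_grundy_coloring adj E k c"
proof (cases "E = {}")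
  case True
  then have "pseudo_grundy_coloring adj E 0 c" for c
    by (simp add: pseudo_grundy_coloring_def)
  then show ?thesis by blast
next
  case False
  then have "pseudo_grundy_coloring adj E 1 (\<lambda>_. 1)"
    unfolding pseudo_grundy_coloring_def by (simp add: image_constant_conv)
  then show ?thesis by blast
qed

lemma complete_convex_graph_finite_edges:
  assumes "complete_convex_graph n V E"
  shows "finite E"
proof -
  have fin: "finite V" and sub: "\<forall>e\<in>E. e \<subseteq> V \<and> card e = 2"
    using assms unfolding complete_convex_graph_def geometric_graph_def by blast+
  have "E \<subseteq> Pow V"
    using sub by blast
  then show ?thesis
    using fin by (rule finite_subset[OF _ finite_Pow_iff[THEN iffD2]])
qed

end

theory Submission
  imports Defs "HOL-Real_Asymp.Real_Asymp"
begin

text \<open>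
  The proof is a double count of the pairs of adjacent edges with different colors. Crossing
  edges intersect, so a coloring for the crossing criterion is one for the intersection criterion,
  and only the latter has to be treated.

  An edge of color \<open>j\<close> is adjacent to an edge of each of the \<open>j - 1\<close> smaller colors. If every color
  class had two edges, this would give at least \<open>\<Sum>j\<le>k. 2 (j - 1) = k (k - 1)\<close> adjacent pairs; each
  color class with one edge lowers the count by at most \<open>k\<close>
  (\<open>pseudo_grundy_coloring_adjacent_pairs\<close>). On the other hand, among the three ways to
  split four points in general position into two segments at most one gives a crossing
  (\<open>crossing_pairing_unique\<close>). So there are at most \<open>n choose 4 \<le> n\<^sup>4 / 24\<close> crossing pairs, and the
  pairs with a common endpoint contribute only \<open>n\<^sup>3\<close> more (\<open>card_intersecting_pairs_le\<close>).

  It remains to see that there are few one-edge color classes. Their edges pairwise intersect. In a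
  4-cycle of such edges both pairs of opposite edges would have to cross, which the uniqueness
  of the crossing split excludes. A graph without 4-cycles has \<open>O(n\<^bsup>3/2\<^esup>)\<close> edges. Hence
  \<open>k\<^sup>2 \<le> n\<^sup>4 / 24 + O(n\<^bsup>7/2\<^esup>)\<close>, and taking square roots gives the bound with the constant
  \<open>1 / sqrt 24\<close>.
\<close>

section \<open>Crossing segments on four points\<close>

text \<open>
  The two crossings are two affine dependences of the four points with different sign patterns.
  Eliminating \<open>d\<close> leaves an affine dependence of \<open>a\<close>, \<open>b\<close>, \<open>c\<close> in which the coefficient
  of \<open>b\<close> is still positive.
\<close>

lemma two_crossing_pairings_imp_collinear:
  fixes a b c d :: "'a::real_vector"
  assumes "open_segment a b \<inter> open_segment c d \<noteq> {}"
    and "open_segment a c \<inter> open_segment b d \<noteq> {}"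
  shows "collinear {a, b, c}"
proof -
  obtain x y where x: "x \<in> open_segment a b" "x \<in> open_segment c d"
    and y: "y \<in> open_segment a c" "y \<in> open_segment b d"
    using assms by blast
  obtain s where s: "0 < s" "s < 1" "x = (1 - s) *\<^sub>R a + s *\<^sub>R b"
    using x(1) by (auto simp: in_segment)
  obtain t where t: "0 < t" "t < 1" "x = (1 - t) *\<^sub>R c + t *\<^sub>R d"
    using x(2) by (auto simp: in_segment)
  obtain u where u: "0 < u" "u < 1" "y = (1 - u) *\<^sub>R a + u *\<^sub>R c"
    using y(1) by (auto simp: in_segment)
  obtain v where v: "0 < v" "v < 1" "y = (1 - v) *\<^sub>R b + v *\<^sub>R d"
    using y(2) by (auto simp: in_segment)
  define q where "q = v * s + t * (1 - v)"
  define r where "r = v * (1 - t) + t * u"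
  have q: "q > 0"
    unfolding q_def using s t v by (simp add: add_pos_pos)
  have "t *\<^sub>R d = (1 - s) *\<^sub>R a + s *\<^sub>R b - (1 - t) *\<^sub>R c"
    using s(3) t(3) by (metis add_diff_cancel_left')
  moreover have "v *\<^sub>R d = (1 - u) *\<^sub>R a + u *\<^sub>R c - (1 - v) *\<^sub>R b"
    using u(3) v(3) by (metis add_diff_cancel_left')
  moreover have "v *\<^sub>R t *\<^sub>R d = t *\<^sub>R v *\<^sub>R d"
    by (simp add: mult.commute)
  ultimately have "v *\<^sub>R ((1 - s) *\<^sub>R a + s *\<^sub>R b - (1 - t) *\<^sub>R c)
      = t *\<^sub>R ((1 - u) *\<^sub>R a + u *\<^sub>R c - (1 - v) *\<^sub>R b)"
    by simp
  then have dep: "q *\<^sub>R (b - a) = r *\<^sub>R (c - a)"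
    unfolding q_def r_def by (simp add: algebra_simps)
  have "b - a = (1 / q) *\<^sub>R (q *\<^sub>R (b - a))"
    using q by simp
  also have "\<dots> = (r / q) *\<^sub>R (c - a)"
    unfolding dep by simp
  finally have "b = (1 - r / q) *\<^sub>R a + (1 - (1 - r / q)) *\<^sub>R c"
    by (simp add: algebra_simps)
  then show ?thesis
    unfolding collinear_3_expand by blast
qed

lemma edges_cross_doubletons:
  "edges_cross {a, b} {c, d} \<longleftrightarrow>
     {a, b} \<noteq> {c, d} \<and> open_segment a b \<inter> open_segment c d \<noteq> {}"
proof
  assume "edges_cross {a, b} {c, d}"
  then obtain p q r s where *: "{a, b} \<noteq> {c, d}" "{a, b} = {p, q}" "{c, d} = {r, s}"
    "open_segment p q \<inter> open_segment r s \<noteq> {}"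
    unfolding edges_cross_def by blast
  have "open_segment p q = open_segment a b" "open_segment r s = open_segment c d"
    using *(2,3) open_segment_commute unfolding doubleton_eq_iff by blast+
  with * show "{a, b} \<noteq> {c, d} \<and> open_segment a b \<inter> open_segment c d \<noteq> {}"
    by simp
next
  assume "{a, b} \<noteq> {c, d} \<and> open_segment a b \<inter> open_segment c d \<noteq> {}"
  then show "edges_cross {a, b} {c, d}"
    unfolding edges_cross_def by (intro conjI exI[of _ a] exI[of _ b] exI[of _ c] exI[of _ d]) auto
qed

text \<open>
  After renaming, any other split of \<open>{a, b, c, d}\<close> into two pairs exchanges one endpoint of \<open>{a, b}\<close>
  with one of \<open>{c, d}\<close>, which is the situation of the preceding collinearity lemma.
\<close>

lemma crossing_pairing_unique:
  assumes V: "general_position V" "e \<subseteq> V" "f \<subseteq> V"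
    and card: "card e = 2" "card f = 2" "card e' = 2" "card f' = 2"
    and disj: "e \<inter> f = {}" "e' \<inter> f' = {}"
    and un: "e \<union> f = e' \<union> f'"
    and cross: "edges_cross e f" "edges_cross e' f'"
  shows "{e, f} = {e', f'}"
proof -
  have no: False
    if "edges_cross {a, b} {c, d}" "edges_cross {a, c} {b, d}" "{a, b, c} \<subseteq> V"
      "a \<noteq> b" "a \<noteq> c" "b \<noteq> c" for a b c d
    using two_crossing_pairings_imp_collinear[of a b c d] that V(1)
    unfolding edges_cross_doubletons general_position_def by blast
  obtain a b where e: "e = {a, b}" "a \<noteq> b"
    using card(1) by (auto simp: card_2_iff)
  obtain c d where f: "f = {c, d}" "c \<noteq> d"
    using card(2) by (auto simp: card_2_iff)
  obtain p q where e': "e' = {p, q}" "p \<noteq> q"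
    using card(3) by (auto simp: card_2_iff)
  have f': "f' = {a, b, c, d} - {p, q}"
    using un disj e f e' by blast
  have dist: "a \<noteq> c" "a \<noteq> d" "b \<noteq> c" "b \<noteq> d"
    using disj(1) e f by auto
  have comm: "edges_cross g h \<longleftrightarrow> edges_cross h g" for g h
    unfolding edges_cross_def by (metis inf_commute)
  have pq: "p \<in> {a, b, c, d}" "q \<in> {a, b, c, d}"
    using un e f e' by auto
  have ins: "{a, b, c, d} \<subseteq> V"
    using V e f by simp
  have ac_bd: "\<not> edges_cross {a, c} {b, d}"
    using no[of a b c d] cross(1) e f dist ins by auto
  have ad_bc: "\<not> edges_cross {a, d} {b, c}"
    using no[of a b d c] cross(1) e f dist ins by (auto simp: insert_commute)
  have bd_ac: "\<not> edges_cross {b, d} {a, c}" and bc_ad: "\<not> edges_cross {b, c} {a, d}"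
    using ac_bd ad_bc comm by blast+
  consider "{p, q} = {a, b}" | "{p, q} = {c, d}" | "{p, q} = {a, c}" | "{p, q} = {b, d}"
    | "{p, q} = {a, d}" | "{p, q} = {b, c}"
    using pq e'(2) by (auto simp: insert_commute)
  then show ?thesis
  proof cases
    case 1
    then have "f' = {c, d}" using f' dist by auto
    then show ?thesis by (simp only: 1 e(1) f(1) e'(1))
  next
    case 2
    then have "f' = {a, b}" using f' dist by auto
    then show ?thesis by (simp only: 2 e(1) f(1) e'(1) insert_commute)
  next
    case 3
    then have "f' = {b, d}" using f' dist e(2) f(2) by auto
    then have False using ac_bd cross(2) by (simp only: e'(1) 3)
    then show ?thesis ..
  next
    case 4
    then have "f' = {a, c}" using f' dist e(2) f(2) by auto
    then have False using bd_ac cross(2) by (simp only: e'(1) 4)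
    then show ?thesis ..
  next
    case 5
    then have "f' = {b, c}" using f' dist e(2) f(2) by auto
    then have False using ad_bc cross(2) by (simp only: e'(1) 5)
    then show ?thesis ..
  next
    case 6
    then have "f' = {a, d}" using f' dist e(2) f(2) by auto
    then have False using bc_ad cross(2) by (simp only: e'(1) 6)
    then show ?thesis ..
  qed
qed

section \<open>Counting intersecting pairs\<close>

text \<open>
  The coloring \<open>c\<close> serves to orient the pairs: each unordered pair of edges is counted at most once.
  This is what gives \<open>n choose 4\<close> and not twice that number.
\<close>

lemma card_intersecting_pairs_le:
  fixes c :: "edge \<Rightarrow> nat"
  assumes "geometric_graph V E"
  shows "card {(e, f) \<in> E \<times> E. c f < c e \<and> edges_intersect e f}
           \<le> (card V choose 4) + card V ^ 3"
proof -
  have fin: "finite V" and gp: "general_position V"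
    and edge: "\<And>e. e \<in> E \<Longrightarrow> e \<subseteq> V \<and> card e = 2"
    using assms unfolding geometric_graph_def by auto
  define X where "X = {(e, f) \<in> E \<times> E. c f < c e \<and> e \<inter> f = {} \<and> edges_cross e f}"
  define Y where "Y = {(e, f) \<in> E \<times> E. e \<inter> f \<noteq> {}}"
  define F where "F = {A. A \<subseteq> V \<and> card A = 4}"
  have "finite E"
    by (rule finite_subset[of _ "Pow V"]) (use edge fin in auto)
  then have finXY: "finite X" "finite Y"
    unfolding X_def Y_def by (auto intro: finite_subset[of _ "E \<times> E"])
  have "inj_on (\<lambda>(e, f). e \<union> f) X"
  proof (rule inj_onI, clarify)
    fix e f e' f'
    assume "(e, f) \<in> X" "(e', f') \<in> X" and un: "e \<union> f = e' \<union> f'"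
    then have *: "e \<in> E" "f \<in> E" "e' \<in> E" "f' \<in> E" "c f < c e" "c f' < c e'"
      "e \<inter> f = {}" "e' \<inter> f' = {}" "edges_cross e f" "edges_cross e' f'"
      unfolding X_def by auto
    have "{e, f} = {e', f'}"
      by (rule crossing_pairing_unique[OF gp]) (use * un edge in auto)
    then show "e = e' \<and> f = f'"
      using *(5,6) by (auto simp: doubleton_eq_iff)
  qed
  moreover have "(\<lambda>(e, f). e \<union> f) ` X \<subseteq> F"
  proof clarify
    fix e f assume "(e, f) \<in> X"
    then have *: "e \<in> E" "f \<in> E" "e \<inter> f = {}"
      unfolding X_def by auto
    then have "finite e" "finite f"
      using edge fin finite_subset by metis+
    then have "card (e \<union> f) = 4"
      using * edge by (simp add: card_Un_disjoint)
    then show "e \<union> f \<in> F"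
      using * edge unfolding F_def by auto
  qed
  moreover have "finite F"
    unfolding F_def using fin by simp
  ultimately have "card X \<le> card F"
    by (rule card_inj_on_le)
  then have X: "card X \<le> card V choose 4"
    unfolding F_def using n_subsets[OF fin] by simp
  have "Y \<subseteq> (\<lambda>(v, x, y). ({v, x}, {v, y})) ` (V \<times> V \<times> V)"
  proof clarify
    fix e f assume "(e, f) \<in> Y"
    then obtain v where v: "e \<in> E" "f \<in> E" "v \<in> e" "v \<in> f"
      unfolding Y_def by auto
    have "\<exists>x\<in>V. g = {v, x}" if "g \<in> E" "v \<in> g" for g
      using edge[OF that(1)] that(2) by (auto simp: card_2_iff)
    then obtain x y where "x \<in> V" "y \<in> V" "e = {v, x}" "f = {v, y}"
      using v by metis
    moreover have "v \<in> V"
      using v edge by auto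
    ultimately show "(e, f) \<in> (\<lambda>(v, x, y). ({v, x}, {v, y})) ` (V \<times> V \<times> V)"
      by (auto intro!: image_eqI[of _ _ "(v, x, y)"])
  qed
  then have "card Y \<le> card (V \<times> V \<times> V)"
    by (rule surj_card_le[rotated]) (use fin in auto)
  then have Y: "card Y \<le> card V ^ 3"
    by (simp add: card_cartesian_product power3_eq_cube)
  have "{(e, f) \<in> E \<times> E. c f < c e \<and> edges_intersect e f} \<subseteq> X \<union> Y"
    unfolding X_def Y_def edges_intersect_def by auto
  then have "card {(e, f) \<in> E \<times> E. c f < c e \<and> edges_intersect e f} \<le> card (X \<union> Y)"
    by (rule card_mono[rotated]) (use finXY in auto)
  also have "\<dots> \<le> card X + card Y"
    by (rule card_Un_le)
  finally show ?thesis
    using X Y by linarith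
qed

section \<open>Families of pairwise intersecting edges\<close>

text \<open>
  Two-edge paths are counted by their middle vertex and by their endpoints: the sum of the
  squared degrees is at most \<open>2 n\<^sup>2\<close>, where pairs of equal endpoints account for one half. The
  Cauchy-Schwarz inequality turns this into a bound for the sum of the degrees.
\<close>

lemma card_edges_le_if_no_4_cycle:
  fixes S :: "'a set set"
  assumes fin: "finite V"
    and edge: "\<And>e. e \<in> S \<Longrightarrow> e \<subseteq> V \<and> card e = 2"
    and C4: "\<And>a b v w. \<lbrakk>a \<noteq> b; {a, v} \<in> S; {b, v} \<in> S; {a, w} \<in> S; {b, w} \<in> S\<rbrakk> \<Longrightarrow> v = w"
  shows "card S ^ 2 \<le> 2 * card V ^ 3"
proof -
  define N where "N v = {a \<in> V. {a, v} \<in> S}" for v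
  define C where "C p = {v \<in> V. {fst p, v} \<in> S \<and> {snd p, v} \<in> S}" for p
  have finN: "finite (N v)" for v
    unfolding N_def using fin by simp
  have "S \<subseteq> (\<lambda>(v, a). {a, v}) ` Sigma V N"
  proof
    fix e assume "e \<in> S"
    with edge[OF this] show "e \<in> (\<lambda>(v, a). {a, v}) ` Sigma V N"
      unfolding N_def by (force simp: card_2_iff image_iff)
  qed
  then have "card S \<le> card (Sigma V N)"
    by (rule surj_card_le[rotated]) (use fin finN in auto)
  also have "\<dots> = (\<Sum>v\<in>V. card (N v))"
    using fin finN by simp
  finally have deg: "card S \<le> (\<Sum>v\<in>V. card (N v))" .
  have C: "card (C p) \<le> (if fst p = snd p then card V else 1)" if "p \<in> V \<times> V" for p
  proof (cases "fst p = snd p")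
    case True
    then show ?thesis
      unfolding C_def using fin by (auto intro: card_mono)
  next
    case False
    then have "\<forall>v\<in>C p. \<forall>w\<in>C p. v = w"
      unfolding C_def using C4 by blast
    then show ?thesis
      using False fin by (auto simp: C_def intro!: card_le_Suc0_iff_eq[THEN iffD2])
  qed
  have "(\<Sum>v\<in>V. card (N v) ^ 2) = (\<Sum>v\<in>V. card (N v \<times> N v))"
    by (simp add: card_cartesian_product power2_eq_square)
  also have "\<dots> = card (SIGMA v:V. N v \<times> N v)"
    using fin finN by simp
  also have "\<dots> = card (SIGMA p:V \<times> V. C p)"
    by (rule bij_betw_same_card[of "\<lambda>(v, p). (p, v)"])
      (rule bij_betwI[of _ _ _ "\<lambda>(p, v). (v, p)"], auto simp: N_def C_def)
  also have "\<dots> = (\<Sum>p\<in>V \<times> V. card (C p))"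
    by (rule card_SigmaI) (use fin in \<open>auto simp: C_def\<close>)
  also have "\<dots> \<le> (\<Sum>p\<in>V \<times> V. if fst p = snd p then card V else 1)"
    by (intro sum_mono C)
  also have "\<dots> = (\<Sum>a\<in>V. \<Sum>b\<in>V. if a = b then card V else 1)"
    by (simp add: sum.cartesian_product case_prod_unfold)
  also have "\<dots> \<le> (\<Sum>a\<in>V. \<Sum>b\<in>V. (if a = b then card V else 0) + 1)"
    by (intro sum_mono) auto
  also have "\<dots> = 2 * card V ^ 2"
    unfolding sum.distrib using fin by (simp add: power2_eq_square)
  finally have sq: "(\<Sum>v\<in>V. card (N v) ^ 2) \<le> 2 * card V ^ 2" .
  have "real (card S) ^ 2 \<le> (\<Sum>v\<in>V. real (card (N v))) ^ 2"
    using deg by (intro power_mono) (simp_all flip: of_nat_sum)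
  also have "\<dots> \<le> (\<Sum>v\<in>V. real (card (N v)) ^ 2) * card V"
    by (rule sum_squared_le_sum_of_squares)
  also have "\<dots> = real ((\<Sum>v\<in>V. card (N v) ^ 2) * card V)"
    by simp
  also have "\<dots> \<le> real (2 * card V ^ 2 * card V)"
    using sq by (intro of_nat_mono mult_right_mono) auto
  finally have "real (card S ^ 2) \<le> real (2 * card V ^ 3)"
    by (simp add: power2_eq_square power3_eq_cube)
  then show ?thesis
    by (simp only: of_nat_le_iff)
qed

text \<open>
  Such a family has no 4-cycle. Its size therefore has order at most \<open>n\<^bsup>3/2\<^esup>\<close>, which is small enough:
  it enters the estimate for \<open>k\<^sup>2\<close> with a factor \<open>k \<le> n\<^sup>2\<close>, and \<open>n\<^bsup>2 + 3/2\<^esup>\<close> is of smaller order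
  than \<open>n\<^sup>4\<close>.
\<close>

lemma card_pairwise_intersecting_le:
  assumes G: "geometric_graph V S"
    and int: "\<And>e f. \<lbrakk>e \<in> S; f \<in> S; e \<noteq> f\<rbrakk> \<Longrightarrow> edges_intersect e f"
  shows "card S ^ 2 \<le> 2 * card V ^ 3"
proof (rule card_edges_le_if_no_4_cycle)
  show "finite V" and edge: "e \<in> S \<Longrightarrow> e \<subseteq> V \<and> card e = 2" for e
    using G unfolding geometric_graph_def by auto
  fix a b v w
  assume ab: "a \<noteq> b" and S: "{a, v} \<in> S" "{b, v} \<in> S" "{a, w} \<in> S" "{b, w} \<in> S"
  show "v = w"
  proof (rule ccontr)
    assume vw: "v \<noteq> w"
    have dist: "a \<noteq> v" "b \<noteq> v" "a \<noteq> w" "b \<noteq> w"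
      using S[THEN edge] by auto
    have V: "{a, v, w} \<subseteq> V"
      using S[THEN edge] by auto
    \<comment> \<open>Opposite edges of the 4-cycle \<open>a v b w\<close> are disjoint, so they cross.\<close>
    have "edges_intersect {a, v} {b, w}" "edges_intersect {a, w} {b, v}"
      by (rule int; use S ab vw dist in \<open>auto simp: doubleton_eq_iff\<close>)+
    then have "edges_cross {a, v} {b, w}" "edges_cross {a, w} {b, v}"
      using ab vw dist unfolding edges_intersect_def by auto
    then have "collinear {a, v, w}"
      unfolding edges_cross_doubletons
      by (intro two_crossing_pairings_imp_collinear[of a v w b]) (auto simp: open_segment_commute)
    then show False
      using G V dist vw unfolding geometric_graph_def general_position_def by blast
  qed
qed

section \<open>Adjacent pairs forced by a pseudo-Grundy coloring\<close>

text \<open>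
  A class of color \<open>j\<close> with \<open>m\<close> edges forces \<open>m (j - 1)\<close> pairs towards smaller colors. The last
  summand makes up for the classes with \<open>m = 1\<close>, so that every class can be counted as if it had
  at least two edges; its set consists of the edges that are alone in their color.
\<close>

lemma pseudo_grundy_coloring_adjacent_pairs:
  assumes fin: "finite E" and col: "pseudo_grundy_coloring adj E k c"
  shows "k * (k - 1) \<le> card {(e, f) \<in> E \<times> E. c f < c e \<and> adj e f}
                        + k * card {e \<in> E. \<forall>f\<in>E. c f = c e \<longrightarrow> f = e}"
    (is "_ \<le> card ?P + k * card ?S")
proof -
  have im: "c ` E = {1..k}"
    using col unfolding pseudo_grundy_coloring_def by blast
  have ex: "\<exists>f\<in>E. c f = i \<and> adj e f" if "e \<in> E" "i \<in> {1..<c e}" for e i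
  proof -
    have "c e \<in> {1..k}"
      using im that(1) by blast
    then have "i \<in> {1..k}" "i < c e"
      using that(2) by auto
    with \<open>c e \<in> {1..k}\<close> show ?thesis
      using col that(1) unfolding pseudo_grundy_coloring_def by blast
  qed
  define L where "L j = {e \<in> E. c e = j}" for j
  define J where "J = {j \<in> {1..k}. card (L j) = 1}"
  have "(SIGMA e:E. {1..<c e}) \<subseteq> (\<lambda>(e, f). (e, c f)) ` ?P"
    using ex by (fastforce simp: image_iff)
  then have "card (SIGMA e:E. {1..<c e}) \<le> card ?P"
    by (rule surj_card_le[rotated]) (use fin in \<open>auto intro: finite_subset[of _ "E \<times> E"]\<close>)
  then have "(\<Sum>e\<in>E. c e - 1) \<le> card ?P"
    using fin by simp
  moreover have "(\<Sum>e\<in>E. c e - 1) = (\<Sum>j\<in>{1..k}. \<Sum>e\<in>L j. c e - 1)"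
    using sum.image_gen[OF fin, of "\<lambda>e. c e - 1" c] im unfolding L_def by simp
  moreover have "\<dots> = (\<Sum>j\<in>{1..k}. card (L j) * (j - 1))"
    by (intro sum.cong refl) (simp add: L_def)
  ultimately have P: "(\<Sum>j\<in>{1..k}. card (L j) * (j - 1)) \<le> card ?P"
    by simp
  have L: "1 \<le> card (L j)" if "j \<in> {1..k}" for j
  proof -
    have "j \<in> c ` E"
      using that im by simp
    then have "L j \<noteq> {}" "finite (L j)"
      using fin unfolding L_def by auto
    then show ?thesis
      by (simp add: Suc_le_eq card_gt_0_iff)
  qed
  have "J \<subseteq> c ` ?S"
  proof
    fix j assume j: "j \<in> J"
    then obtain e where e: "L j = {e}"
      unfolding J_def by (auto simp: card_1_singleton_iff)
    have e_iff: "x \<in> E \<and> c x = j \<longleftrightarrow> x = e" for x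
      using e unfolding L_def by (simp add: set_eq_iff)
    have e_col: "e \<in> E" "c e = j"
      using e_iff[of e] by simp_all
    have alone: "f = e" if "f \<in> E" "c f = c e" for f
      using e_iff[of f] that e_col by simp
    have "e \<in> ?S"
      by (intro CollectI conjI ballI impI alone e_col(1))
    then show "j \<in> c ` ?S"
      using e_col(2) by (intro rev_image_eqI) auto
  qed
  then have J: "card J \<le> card ?S"
    by (rule surj_card_le[rotated]) (use fin in auto)
  have "k * (k - 1) = (\<Sum>j\<in>{1..k}. 2 * (j - 1))"
  proof (induction k)
    case (Suc k)
    then show ?case by (cases k) auto
  qed simp
  also have "\<dots> \<le> (\<Sum>j\<in>{1..k}. card (L j) * (j - 1) + (if card (L j) = 1 then k else 0))"
  proof (rule sum_mono)
    fix j assume j: "j \<in> {1..k}"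
    consider "card (L j) = 1" | "2 \<le> card (L j)"
      using L[OF j] by linarith
    then show "2 * (j - 1) \<le> card (L j) * (j - 1) + (if card (L j) = 1 then k else 0)"
    proof cases
      case 1
      with j show ?thesis by auto
    next
      case 2
      then show ?thesis by (intro trans_le_add1 mult_right_mono) auto
    qed
  qed
  also have "\<dots> = (\<Sum>j\<in>{1..k}. card (L j) * (j - 1)) + k * card J"
    unfolding J_def by (simp add: sum.distrib flip: sum.inter_filter)
  also have "\<dots> \<le> card ?P + k * card ?S"
    using P J by (intro add_mono mult_left_mono) auto
  finally show ?thesis .
qed

section \<open>The bound\<close>

lemma pseudo_grundy_coloring_edges_intersect:
  assumes "pseudo_grundy_coloring edges_cross E k c"
  shows "pseudo_grundy_coloring edges_intersect E k c"
proof -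
  have "edges_intersect e f" if "edges_cross e f" for e f
    using that unfolding edges_intersect_def edges_cross_def by blast
  then show ?thesis
    using assms unfolding pseudo_grundy_coloring_def by meson
qed

lemma pseudo_grundy_index_attained:
  assumes "finite E"
  shows "\<exists>c. pseudo_grundy_coloring adj E (pseudo_grundy_index adj E) c"
  using Max_in[OF finite_pseudo_grundy_colorings[OF assms]] ex_pseudo_grundy_coloring
  unfolding pseudo_grundy_index_def by blast

lemma pseudo_grundy_coloring_intersect_le:
  assumes G: "geometric_graph V E" and n: "card V = n"
    and col: "pseudo_grundy_coloring edges_intersect E k c"
  shows "real k \<le> real n ^ 2 / sqrt 24 + sqrt (real n ^ 3 + real n ^ 2 + real n ^ 2 * sqrt (2 * real n ^ 3))"
    (is "_ \<le> _ + sqrt ?r")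
proof -
  have fin: "finite V" and edge: "\<And>e. e \<in> E \<Longrightarrow> e \<subseteq> V \<and> card e = 2"
    using G unfolding geometric_graph_def by auto
  have sub: "E \<subseteq> {e. e \<subseteq> V \<and> card e = 2}"
    using edge by blast
  have finE: "finite E"
    by (rule finite_subset[OF sub]) (use fin in simp)
  have "card E \<le> n choose 2"
    using card_mono[OF _ sub] n_subsets[OF fin, of 2] fin n by simp
  also have "\<dots> \<le> n ^ 2"
    using binomial_fact_pow[of n 2] by (simp add: fact_2)
  finally have kn: "k \<le> n ^ 2"
    using pseudo_grundy_coloring_le_card[OF finE col] by linarith
  define S where "S = {e \<in> E. \<forall>f\<in>E. c f = c e \<longrightarrow> f = e}"
  \<comment> \<open>The edge of smaller color is the only one of its color, so it must be the adjacent one.\<close>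
  have "edges_intersect e f" if "e \<in> S" "f \<in> S" "e \<noteq> f" for e f
  proof -
    have int: "edges_intersect g h" if gh: "g \<in> S" "h \<in> S" "c h < c g" for g h
    proof -
      have "c ` E = {1..k}" "g \<in> E" "h \<in> E"
        using col gh unfolding pseudo_grundy_coloring_def S_def by auto
      then have "c g \<in> {1..k}" "c h \<in> {1..k}"
        by blast+
      then obtain f where "f \<in> E" "c f = c h" "edges_intersect g f"
        using col gh(3) \<open>g \<in> E\<close> unfolding pseudo_grundy_coloring_def by blast
      then show ?thesis
        using gh(2) unfolding S_def by auto
    qed
    have "c e \<noteq> c f"
      using that unfolding S_def by auto
    moreover have "edges_intersect f e \<Longrightarrow> edges_intersect e f"
      unfolding edges_intersect_def edges_cross_def by (metis inf_commute)
    ultimately show ?thesis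
      using int[of e f] int[of f e] that by (cases "c e < c f") auto
  qed
  moreover have "geometric_graph V S"
    using G unfolding geometric_graph_def S_def by auto
  ultimately have "card S ^ 2 \<le> 2 * n ^ 3"
    using card_pairwise_intersecting_le n by blast
  then have "real (card S ^ 2) \<le> real (2 * n ^ 3)"
    by (simp only: of_nat_le_iff)
  then have S: "real (card S) \<le> sqrt (2 * real n ^ 3)"
    by (intro real_le_rsqrt) simp
  have "k * (k - 1) \<le> card {(e, f) \<in> E \<times> E. c f < c e \<and> edges_intersect e f} + k * card S"
    unfolding S_def by (rule pseudo_grundy_coloring_adjacent_pairs[OF finE col])
  also have "\<dots> \<le> (n choose 4) + n ^ 3 + k * card S"
    using card_intersecting_pairs_le[OF G, of c] unfolding n by (rule add_right_mono)
  finally have "k * (k - 1) \<le> (n choose 4) + n ^ 3 + k * card S" .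
  moreover have "k ^ 2 = k * (k - 1) + k"
    by (cases k) (auto simp: power2_eq_square)
  ultimately have "k ^ 2 \<le> (n choose 4) + n ^ 3 + k * card S + k"
    by linarith
  then have "real (k ^ 2) \<le> real ((n choose 4) + n ^ 3 + k * card S + k)"
    by (simp only: of_nat_le_iff)
  moreover have "real ((n choose 4) * fact 4) \<le> real (n ^ 4)"
    by (simp only: of_nat_le_iff binomial_fact_pow)
  then have "real (n choose 4) \<le> real n ^ 4 / 24"
    by (simp add: fact_numeral)
  moreover have k: "real k \<le> real n ^ 2"
    using kn by (metis of_nat_le_iff of_nat_power)
  moreover have "real k * real (card S) \<le> real n ^ 2 * sqrt (2 * real n ^ 3)"
    by (intro mult_mono k S) auto
  ultimately have "real k ^ 2 \<le> real n ^ 4 / 24 + ?r"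
    unfolding of_nat_add of_nat_mult of_nat_power by linarith
  then have "real k \<le> sqrt (real n ^ 4 / 24 + ?r)"
    by (rule real_le_rsqrt)
  also have "\<dots> \<le> sqrt (real n ^ 4 / 24) + sqrt ?r"
    by (rule sqrt_add_le_add_sqrt) auto
  also have "sqrt (real n ^ 4 / 24) = real n ^ 2 / sqrt 24"
    using real_sqrt_abs[of "real n ^ 2"] by (simp add: real_sqrt_divide)
  finally show ?thesis .
qed

theorem theorem4:
  fixes V :: "nat \<Rightarrow> point set" and E :: "nat \<Rightarrow> edge set"
    and adj :: "edge \<Rightarrow> edge \<Rightarrow> bool"
  assumes "\<And>n. complete_convex_graph n (V n) (E n)"
    and "adj = edges_intersect \<or> adj = edges_cross"
  shows "(\<lambda>n. real (pseudo_grundy_index adj (E n))) \<in> O(\<lambda>n. real n ^ 2 / sqrt 24) \<and>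
         (\<exists>h :: nat \<Rightarrow> real. h \<in> o(\<lambda>n. real n ^ 2) \<and>
            (\<forall>n. real (pseudo_grundy_index adj (E n)) \<le> real n ^ 2 / sqrt 24 + h n))"
proof -
  define h :: "nat \<Rightarrow> real" where
    "h n = sqrt (real n ^ 3 + real n ^ 2 + real n ^ 2 * sqrt (2 * real n ^ 3))" for n
  have le: "real (pseudo_grundy_index adj (E n)) \<le> real n ^ 2 / sqrt 24 + h n" for n
  proof -
    have G: "geometric_graph (V n) (E n)" "card (V n) = n"
      using assms(1)[of n] unfolding complete_convex_graph_def by auto
    obtain c where "pseudo_grundy_coloring adj (E n) (pseudo_grundy_index adj (E n)) c"
      using pseudo_grundy_index_attained[OF complete_convex_graph_finite_edges[OF assms(1)]]
      by blast
    then have "pseudo_grundy_coloring edges_intersect (E n) (pseudo_grundy_index adj (E n)) c"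
      using assms(2) pseudo_grundy_coloring_edges_intersect by blast
    then show ?thesis
      using pseudo_grundy_coloring_intersect_le[OF G] unfolding h_def by blast
  qed
  have h: "h \<in> o(\<lambda>n. real n ^ 2)"
    unfolding h_def by real_asymp
  have "(\<lambda>n. real (pseudo_grundy_index adj (E n))) \<in> O(\<lambda>n. real n ^ 2 / sqrt 24 + h n)"
    using le by (intro landau_o.big_mono always_eventually allI) (smt (verit) real_norm_def of_nat_0_le_iff)
  also have "(\<lambda>n. real n ^ 2 / sqrt 24 + h n) \<in> O(\<lambda>n. real n ^ 2 / sqrt 24)"
    unfolding h_def by real_asymp
  finally show ?thesis
    using h le by blast
qed

end
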